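(* For every integer $n \geq 1$ and every partition $\lambda$ of $n$, $$\sum_{u \in \lambda} h(u)^2 = n^2 + \sum_{u \in \lambda} c(u)^2,$$ where the sums run over all cells $u$ of the Young diagram of $\lambda$, $h(u)$ is the hook length of $u$ and $c(u)$ is the content of $u$.
   Context: A partition $\lambda$ of $n$ (written $\lambda \vdash n$) is a weakly decreasing sequence of non-negative integers $\lambda_1 \geq \lambda_2 \geq \cdots$ with sum $n$. It is identified with its Young diagram, which has $\lambda_i$ boxes (cells) in the $i$-th row from the top; cells are indexed like matrix entries, so $(i,j) \in \lambda$ iff $i \ge 1$ and $1 \le j \le \lambda_i$. For a cell $u=(i,j) \in \lambda$, the hook $H(u)$ is the set of cells $(k,l) \in \lambda$ such that either $k=i$ and $l \geq j$, or $l=j$ and $k \geq i$. The hook length is $h(u) = |H(u)|$. The content of $u=(i,j)$ is $c(u) = j-i$. *)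

theory Defs
  imports Main
begin

(* A partition is a sequence lam 1 >= lam 2 >= ... of naturals, finitely many of them
   nonzero. Parts are indexed from 1; the value lam 0 is never used. The finiteness
   condition is explicit because sum over an infinite index set is 0 in HOL. *)
definition is_partition :: "(nat \<Rightarrow> nat) \<Rightarrow> nat \<Rightarrow> bool" (infix "\<turnstile>" 50) where
  "lam \<turnstile> n \<longleftrightarrow>
     (\<forall>i\<ge>1. lam (i + 1) \<le> lam i) \<and>
     finite {i. 1 \<le> i \<and> lam i \<noteq> 0} \<and>
     (\<Sum>i | 1 \<le> i \<and> lam i \<noteq> 0. lam i) = n"

definition young_diagram :: "(nat \<Rightarrow> nat) \<Rightarrow> (nat \<times> nat) set" where
  "young_diagram lam = {(i, j). 1 \<le> i \<and> 1 \<le> j \<and> j \<le> lam i}"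

definition hook :: "(nat \<Rightarrow> nat) \<Rightarrow> nat \<times> nat \<Rightarrow> (nat \<times> nat) set" where
  "hook lam = (\<lambda>(i, j).
     {(k, l) \<in> young_diagram lam. (k = i \<and> j \<le> l) \<or> (l = j \<and> i \<le> k)})"

definition hook_length :: "(nat \<Rightarrow> nat) \<Rightarrow> nat \<times> nat \<Rightarrow> nat" where
  "hook_length lam u = card (hook lam u)"

definition content :: "nat \<times> nat \<Rightarrow> int" where
  "content = (\<lambda>(i, j). int j - int i)"

end

theory Submission
  imports Defs
begin

text \<open>
  The proof removes the first column of the diagram and inducts on \<open>n\<close>. Let \<open>lam\<close> have \<open>k\<close>
  nonzero rows, and let \<open>\<mu>\<close> be the partition of \<open>n - k\<close> with rows \<open>lam i - 1\<close>. Hooks extend only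
  to the right and downwards, so every cell off the first column of \<open>lam\<close> has the same hook length
  as the corresponding cell of \<open>\<mu>\<close> (\<open>hook_length_shift\<close>), while its content exceeds the one in
  \<open>\<mu>\<close> by \<open>1\<close>. The cell \<open>(i, 1)\<close> has hook length \<open>lam i + k - i\<close> and content \<open>1 - i\<close>. Subtracting
  the identity for \<open>\<mu>\<close> from the one for \<open>lam\<close> therefore leaves
  \[ \sum_{i \le k} (lam_i + k - i)^2 = n^2 - (n-k)^2 + \sum_{i \le k} (i-1)^2
       + 2 \sum_{u \in \mu} c(u) + (n-k). \]
  The content sum of \<open>\<mu>\<close> is computed row by row (\<open>double_sum_content\<close>), which turns both sides
  into sums over rows. The terms that involve \<open>\<mu>\<close> then agree in each row. The others, after the row
  order is reversed on the left, differ by the telescoping sum of \<open>i\<^sup>2 - (i - 1)\<^sup>2\<close>, which is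
  the missing \<open>k\<^sup>2\<close> (\<open>sum_squares_first_column_hooks\<close>). No column length other than \<open>k\<close> enters
  the computation.
\<close>

lemma support_eq_atLeastAtMost:
  assumes "lam \<turnstile> n"
  obtains k where "{i. 1 \<le> i \<and> lam i \<noteq> 0} = {1..k}"
proof -
  let ?S = "{i. 1 \<le> i \<and> lam i \<noteq> 0}"
  have fin: "finite ?S" and step: "\<And>i. 1 \<le> i \<Longrightarrow> lam (i + 1) \<le> lam i"
    using assms by (auto simp: is_partition_def)
  have anti: "lam j \<le> lam i" if "1 \<le> i" "i \<le> j" for i j
    using that(2)
  proof (induction j rule: dec_induct)
    case (step m)
    then show ?case using \<open>\<And>i. 1 \<le> i \<Longrightarrow> lam (i + 1) \<le> lam i\<close>[of m] that(1) by simp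
  qed simp
  show thesis
  proof (cases "?S = {}")
    case True
    then show thesis using that[of 0] by auto
  next
    case False
    have "Max ?S \<in> ?S" using fin False by (rule Max_in)
    then have "i \<in> ?S" if "i \<in> {1..Max ?S}" for i
      using anti[of i "Max ?S"] that by simp
    moreover have "i \<in> {1..Max ?S}" if "i \<in> ?S" for i
      using that Max_ge[OF fin that] by simp
    ultimately have "?S = {1..Max ?S}" by blast
    then show thesis by (rule that)
  qed
qed

text \<open>Rows of length zero are allowed here: a diagram can be summed over the rows of a larger one.\<close>

lemma sum_young_diagram:
  assumes "\<And>i. 1 \<le> i \<Longrightarrow> lam i \<noteq> 0 \<Longrightarrow> i \<le> k"
  shows "(\<Sum>u\<in>young_diagram lam. f u) = (\<Sum>i=1..k. \<Sum>j=1..lam i. f (i, j))"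
proof -
  have "young_diagram lam = Sigma {1..k} (\<lambda>i. {1..lam i})"
    using assms by (fastforce simp: young_diagram_def)
  then show ?thesis by (simp add: sum.Sigma)
qed

lemma sum_young_diagram_split_first_column:
  assumes supp: "{i. 1 \<le> i \<and> lam i \<noteq> 0} = {1..k}"
  shows "(\<Sum>u\<in>young_diagram lam. f u) =
    (\<Sum>i=1..k. f (i, 1)) + (\<Sum>(i, j)\<in>young_diagram (\<lambda>i. lam i - 1). f (i, j + 1))"
proof -
  have row: "(\<Sum>j=1..lam i. f (i, j)) = f (i, 1) + (\<Sum>j=1..lam i - 1. f (i, j + 1))"
    if i: "i \<in> {1..k}" for i
  proof -
    obtain m where m: "lam i = Suc m"
      using i eqset_imp_iff[OF supp, of i] not0_implies_Suc[of "lam i"] by auto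
    have "(\<Sum>j=1..Suc m. f (i, j)) = f (i, 1) + (\<Sum>j=Suc 1..Suc m. f (i, j))"
      by (subst sum.atLeast_Suc_atMost) auto
    then show ?thesis unfolding m sum.shift_bounds_cl_Suc_ivl by simp
  qed
  have "i \<le> k" if "1 \<le> i" "lam i \<noteq> 0" for i
    using that eqset_imp_iff[OF supp, of i] by simp
  moreover from this have "i \<le> k" if "1 \<le> i" "lam i - 1 \<noteq> 0" for i
    using that by simp
  ultimately show ?thesis
    by (simp add: sum_young_diagram[where k = k] row sum.distrib del: One_nat_def)
qed

text \<open>A hook contains no cell to the left of its corner, so it does not see the removed column.\<close>

lemma hook_length_shift:
  assumes "1 \<le> j"
  shows "hook_length lam (i, j + 1) = hook_length (\<lambda>i. lam i - 1) (i, j)"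
proof -
  let ?s = "\<lambda>(k, l). (k, l + 1 :: nat)"
  have "hook lam (i, j + 1) = ?s ` hook (\<lambda>i. lam i - 1) (i, j)" (is "?A = ?B")
  proof (rule set_eqI)
    fix u :: "nat \<times> nat"
    obtain k l where u: "u = (k, l)" by (cases u)
    show "u \<in> ?A \<longleftrightarrow> u \<in> ?B"
      using assms unfolding u
      by (cases l) (auto simp: hook_def young_diagram_def image_iff)
  qed
  moreover have "inj_on ?s X" for X by (auto simp: inj_on_def)
  ultimately show ?thesis unfolding hook_length_def by (metis card_image)
qed

lemma hook_length_first_column:
  assumes supp: "{i. 1 \<le> i \<and> lam i \<noteq> 0} = {1..k}" and i: "i \<in> {1..k}"
  shows "int (hook_length lam (i, 1)) = int (lam i) + int k - int i"
proof -
  have pos: "1 \<le> r \<and> lam r \<noteq> 0 \<longleftrightarrow> r \<in> {1..k}" for r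
    using eqset_imp_iff[OF supp, of r] by simp
  have "hook lam (i, 1) = {i} \<times> {1..lam i} \<union> {i<..k} \<times> {1}" (is "_ = ?R")
  proof (rule set_eqI)
    fix u :: "nat \<times> nat"
    obtain r l where u: "u = (r, l)" by (cases u)
    show "u \<in> hook lam (i, 1) \<longleftrightarrow> u \<in> ?R"
      using i pos[of r] pos[of i] unfolding u by (auto simp: hook_def young_diagram_def)
  qed
  moreover have "card ?R = lam i + (k - i)"
    by (subst card_Un_disjoint) (auto simp: card_cartesian_product)
  ultimately show ?thesis using i by (simp add: hook_length_def of_nat_diff)
qed

lemma double_sum_content:
  assumes "\<And>i. 1 \<le> i \<Longrightarrow> \<mu> i \<noteq> 0 \<Longrightarrow> i \<le> k"
  shows "2 * (\<Sum>u\<in>young_diagram \<mu>. content u) =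
    (\<Sum>i=1..k. int (\<mu> i) * (int (\<mu> i) + 1) - 2 * int i * int (\<mu> i))"
proof -
  have "2 * (\<Sum>j=1..m. content (i, j)) = int m * (int m + 1) - 2 * int i * int m" for i m
    by (induction m) (auto simp: content_def algebra_simps)
  then show ?thesis
    by (simp add: sum_young_diagram[OF assms] sum_distrib_left[of 2])
qed

lemma card_young_diagram:
  assumes "lam \<turnstile> n"
  shows "card (young_diagram lam) = n"
proof -
  obtain k where supp: "{i. 1 \<le> i \<and> lam i \<noteq> 0} = {1..k}"
    using support_eq_atLeastAtMost[OF assms] .
  have "card (young_diagram lam) = (\<Sum>i=1..k. lam i)"
    using sum_young_diagram[of lam k "\<lambda>_. 1 :: nat"] eqset_imp_iff[OF supp] by force
  also have "\<dots> = n"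
    using assms unfolding is_partition_def supp by simp
  finally show ?thesis .
qed

lemma is_partition_remove_first_column:
  assumes part: "lam \<turnstile> n" and supp: "{i. 1 \<le> i \<and> lam i \<noteq> 0} = {1..k}"
  shows "(\<lambda>i. lam i - 1) \<turnstile> n - k"
proof -
  let ?S = "{i. 1 \<le> i \<and> lam i - 1 \<noteq> 0}"
  have sub: "?S \<subseteq> {1..k}"
    unfolding supp[symmetric] by auto
  have "(\<Sum>i\<in>?S. lam i - 1) = (\<Sum>i=1..k. lam i - 1)"
    by (rule sum.mono_neutral_left) (use sub in auto)
  also have "\<dots> = (\<Sum>i=1..k. lam i) - k"
  proof (subst sum_subtractf_nat)
    show "1 \<le> lam i" if "i \<in> {1..k}" for i
      using that eqset_imp_iff[OF supp, of i] by simp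
  qed simp
  also have "(\<Sum>i=1..k. lam i) = n"
    using part unfolding is_partition_def supp by simp
  finally have "(\<Sum>i\<in>?S. lam i - 1) = n - k" .
  moreover have "finite ?S" using sub by (rule finite_subset) simp
  ultimately show ?thesis
    using part by (auto simp: is_partition_def intro: diff_le_mono)
qed

text \<open>
  The numerical identity to which the induction step reduces, with \<open>m i\<close> the length of row \<open>i\<close>
  after the first column has been removed.
\<close>

lemma sum_squares_first_column_hooks:
  fixes m :: "nat \<Rightarrow> int" and k :: nat
  defines "N \<equiv> (\<Sum>i=1..k. m i)"
  shows "(\<Sum>i=1..k. (m i + 1 + int k - int i)\<^sup>2) + N\<^sup>2 =
    (N + int k)\<^sup>2 + (\<Sum>i=1..k. (1 - int i)\<^sup>2)
      + (\<Sum>i=1..k. m i * (m i + 1) - 2 * int i * m i) + N"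
proof -
  \<comment> \<open>The leg lengths plus one in the first column run through the row indices in reverse order.\<close>
  have rev: "(\<Sum>i=1..k. (int k + 1 - int i)\<^sup>2) = (\<Sum>i=1..k. (int i)\<^sup>2)"
    by (subst (2) sum.atLeastAtMost_rev) (auto intro!: sum.cong simp: of_nat_diff algebra_simps)
  have telescope: "(\<Sum>i=1..k. (int i)\<^sup>2) = (\<Sum>i=1..k. (1 - int i)\<^sup>2) + (int k)\<^sup>2"
    by (induction k) (auto simp: power2_eq_square algebra_simps)
  have "(\<Sum>i=1..k. (m i + 1 + int k - int i)\<^sup>2) =
    (\<Sum>i=1..k. (int k + 1 - int i)\<^sup>2
       + ((m i * (m i + 1) - 2 * int i * m i) + (2 * int k + 1) * m i))"
    by (rule sum.cong) (auto simp: power2_eq_square algebra_simps)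
  also have "\<dots> = (\<Sum>i=1..k. (1 - int i)\<^sup>2) + (int k)\<^sup>2
      + ((\<Sum>i=1..k. m i * (m i + 1) - 2 * int i * m i) + (2 * int k + 1) * N)"
    unfolding sum.distrib rev telescope by (simp only: N_def sum_distrib_left)
  finally show ?thesis by (simp add: power2_eq_square algebra_simps)
qed

theorem theorem1p1:
  fixes n :: nat and lam :: "nat \<Rightarrow> nat"
  assumes "n \<ge> 1" and "lam \<turnstile> n"
  shows "(\<Sum>u\<in>young_diagram lam. (int (hook_length lam u))\<^sup>2) =
         (int n)\<^sup>2 + (\<Sum>u\<in>young_diagram lam. (content u)\<^sup>2)"
  \<comment> \<open>Removing a column may leave the empty partition, so the induction starts at \<open>n = 0\<close>.\<close>
  using assms(2)
proof (induction n arbitrary: lam rule: less_induct)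
  case (less n)
  obtain k where supp: "{i. 1 \<le> i \<and> lam i \<noteq> 0} = {1..k}"
    using support_eq_atLeastAtMost[OF less.prems] .
  let ?mu = "\<lambda>i. lam i - 1"
  have n: "(\<Sum>i=1..k. lam i) = n"
    using less.prems unfolding is_partition_def supp by simp
  have pos: "1 \<le> lam i" if "i \<in> {1..k}" for i
    using that eqset_imp_iff[OF supp, of i] by simp
  have bound: "i \<le> k" if "1 \<le> i" "?mu i \<noteq> 0" for i
    using that eqset_imp_iff[OF supp, of i] by simp
  have mu: "?mu \<turnstile> n - k"
    using less.prems supp by (rule is_partition_remove_first_column)
  show ?case
  proof (cases "k = 0")
    case True
    have "young_diagram lam = {}"
      using eqset_imp_iff[OF supp] True by (force simp: young_diagram_def)
    then show ?thesis using n True by simp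
  next
    case False
    have "k \<le> n"
      using sum_mono[of "{1..k}" "\<lambda>_. 1" lam] pos n by simp
    define N where "N = (\<Sum>i=1..k. int (?mu i))"
    have "int n = (\<Sum>i=1..k. int (?mu i) + 1)"
      unfolding n[symmetric] of_nat_sum by (rule sum.cong) (use pos in \<open>auto simp: of_nat_diff\<close>)
    then have nN: "int n = N + int k" by (simp add: sum.distrib N_def)
    have NN: "int (n - k) = N" using nN \<open>k \<le> n\<close> by (simp add: of_nat_diff)

    have "(\<Sum>u\<in>young_diagram lam. (int (hook_length lam u))\<^sup>2) =
      (\<Sum>i=1..k. (int (?mu i) + 1 + int k - int i)\<^sup>2)
        + (\<Sum>u\<in>young_diagram ?mu. (int (hook_length ?mu u))\<^sup>2)"
      unfolding sum_young_diagram_split_first_column[OF supp]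
    proof (intro arg_cong2[where f = "(+)"] sum.cong refl)
      fix i assume "i \<in> {1..k}"
      then show "(int (hook_length lam (i, 1)))\<^sup>2 = (int (?mu i) + 1 + int k - int i)\<^sup>2"
        using hook_length_first_column[OF supp] pos[of i] by (simp add: of_nat_diff)
    next
      fix u assume "u \<in> young_diagram ?mu"
      then show "(case u of (i, j) \<Rightarrow> (int (hook_length lam (i, j + 1)))\<^sup>2) =
        (int (hook_length ?mu u))\<^sup>2"
        using hook_length_shift[of "snd u" lam "fst u"] by (cases u) (simp add: young_diagram_def)
    qed
    also have "(\<Sum>u\<in>young_diagram ?mu. (int (hook_length ?mu u))\<^sup>2) =
      N\<^sup>2 + (\<Sum>u\<in>young_diagram ?mu. (content u)\<^sup>2)"
      using less.IH[OF _ mu] False \<open>k \<le> n\<close> NN by simp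
    finally have hooks: "(\<Sum>u\<in>young_diagram lam. (int (hook_length lam u))\<^sup>2) =
      (\<Sum>i=1..k. (int (?mu i) + 1 + int k - int i)\<^sup>2)
        + (N\<^sup>2 + (\<Sum>u\<in>young_diagram ?mu. (content u)\<^sup>2))" .

    have "(\<Sum>u\<in>young_diagram lam. (content u)\<^sup>2) =
      (\<Sum>i=1..k. (1 - int i)\<^sup>2) + (\<Sum>u\<in>young_diagram ?mu. (content u)\<^sup>2 + 2 * content u + 1)"
      unfolding sum_young_diagram_split_first_column[OF supp]
      by (intro arg_cong2[where f = "(+)"] sum.cong refl)
        (auto simp: content_def power2_eq_square algebra_simps)
    also have "(\<Sum>u\<in>young_diagram ?mu. (content u)\<^sup>2 + 2 * content u + 1) =
      (\<Sum>u\<in>young_diagram ?mu. (content u)\<^sup>2) + 2 * (\<Sum>u\<in>young_diagram ?mu. content u) + N"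
      using card_young_diagram[OF mu] NN by (simp add: sum.distrib sum_distrib_left)
    also have "2 * (\<Sum>u\<in>young_diagram ?mu. content u) =
      (\<Sum>i=1..k. int (?mu i) * (int (?mu i) + 1) - 2 * int i * int (?mu i))"
      using bound by (rule double_sum_content)
    finally show ?thesis
      using hooks sum_squares_first_column_hooks[where m = "\<lambda>i. int (?mu i)" and k = k]
      unfolding nN N_def[symmetric] by linarith
  qed
qed

end
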